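(* Let $\hat\gamma:2\pi\mathbb{T}\to(0,\infty)$ and let $\hat{\boldsymbol Z}:2\pi\mathbb{T}\to\mathbb{R}^{2\times2}$ be any matrix-valued function satisfying $$\begin{pmatrix}\cos\theta&\sin\theta\end{pmatrix}\hat{\boldsymbol Z}(\theta)\begin{pmatrix}\cos\theta\\ \sin\theta\end{pmatrix}=\hat\gamma(\theta)\qquad\forall\theta\in2\pi\mathbb{T}.$$ Suppose the local energy estimate $$\frac{1}{|\boldsymbol q|}\bigl(\hat{\boldsymbol Z}(\theta)\boldsymbol p\bigr)\cdot(\boldsymbol p-\boldsymbol q)\ \ge\ \hat\gamma(\varphi)|\boldsymbol p|-\hat\gamma(\theta)|\boldsymbol q|$$ holds for all $\boldsymbol p=|\boldsymbol p|(\cos\varphi,\sin\varphi)^T$ and $\boldsymbol q=|\boldsymbol q|(\cos\theta,\sin\theta)^T$ in $\mathbb{R}^2\setminus\{\boldsymbol0\}$. Then $3\hat\gamma(\theta)-\hat\gamma(\theta-\pi)\ge0$ for all $\theta\in2\pi\mathbb{T}$.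
   Context: $2\pi\mathbb{T}=\mathbb{R}/2\pi\mathbb{Z}$; functions on it are $2\pi$-periodic functions on $\mathbb{R}$. $|\cdot|$ and $\cdot$ denote the Euclidean norm and inner product on $\mathbb{R}^2$. *)

theory Defs
  imports "HOL-Analysis.Analysis"
begin

definition unit_dir :: "real \<Rightarrow> real^2" where
  "unit_dir \<theta> = vector [cos \<theta>, sin \<theta>]"

(* A function on the torus R/(2 pi Z) is represented by a 2 pi-periodic function on R. *)
definition on_torus :: "(real \<Rightarrow> 'a) \<Rightarrow> bool" where
  "on_torus f \<longleftrightarrow> (\<forall>\<theta>. f (\<theta> + 2 * pi) = f \<theta>)"

definition local_energy_estimate :: "(real \<Rightarrow> real) \<Rightarrow> (real \<Rightarrow> real^2^2) \<Rightarrow> bool" where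
  "local_energy_estimate \<gamma> Z \<longleftrightarrow>
     (\<forall>(p::real^2) (q::real^2) \<phi> \<theta>.
        p \<noteq> 0 \<longrightarrow> q \<noteq> 0 \<longrightarrow>
        p = norm p *\<^sub>R unit_dir \<phi> \<longrightarrow> q = norm q *\<^sub>R unit_dir \<theta> \<longrightarrow>
        (1 / norm q) * ((Z \<theta> *v p) \<bullet> (p - q)) \<ge> \<gamma> \<phi> * norm p - \<gamma> \<theta> * norm q)"

end

theory Submission
  imports Defs
begin

text \<open>
  The estimate is tested on two opposite unit vectors, \<open>q = u\<close> and \<open>p = - u\<close> with
  \<open>u = (cos \<theta>, sin \<theta>)\<close>. Then \<open>p - q = - 2 u\<close> is parallel to \<open>u\<close>, so the left-hand
  side only sees the quadratic form \<open>u \<bullet> Z(\<theta>) u = \<gamma>(\<theta>)\<close> and equals \<open>2 \<gamma>(\<theta>)\<close>, whatever the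
  other entries of \<open>Z(\<theta>)\<close> are. The right-hand side is \<open>\<gamma>(\<theta> - \<pi>) - \<gamma>(\<theta>)\<close>. Equal lengths are
  the best choice: for \<open>p = - r u\<close> the estimate bounds \<open>\<gamma>(\<theta> - \<pi>) / \<gamma>(\<theta>)\<close> by
  \<open>r + 1 + 1 / r\<close>, which is minimal at \<open>r = 1\<close>.
\<close>

lemma norm_unit_dir: "norm (unit_dir \<theta>) = 1"
  by (simp add: unit_dir_def norm_eq_1 inner_vec_def sum_2 flip: power2_eq_square)

lemma unit_dir_minus_pi: "unit_dir (\<theta> - pi) = - unit_dir \<theta>"
  by (simp add: unit_dir_def vec_eq_iff forall_2)

theorem mainTheorem4:
  fixes \<gamma> :: "real \<Rightarrow> real" and Z :: "real \<Rightarrow> real^2^2"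
  assumes "on_torus \<gamma>" and "\<And>\<theta>. \<gamma> \<theta> > 0"
    and "on_torus Z"
    and "\<And>\<theta>. unit_dir \<theta> \<bullet> (Z \<theta> *v unit_dir \<theta>) = \<gamma> \<theta>"
    and "local_energy_estimate \<gamma> Z"
  shows "\<forall>\<theta>. 3 * \<gamma> \<theta> - \<gamma> (\<theta> - pi) \<ge> 0"
proof
  fix \<theta>
  define u where "u = unit_dir \<theta>"
  have norm_u: "norm u = 1"
    by (simp add: u_def norm_unit_dir)
  then have "u \<noteq> 0"
    by auto
  have "(1 / norm u) * ((Z \<theta> *v (- u)) \<bullet> (- u - u))
      \<ge> \<gamma> (\<theta> - pi) * norm (- u) - \<gamma> \<theta> * norm u"
    using assms(5)[unfolded local_energy_estimate_def, rule_format, of "- u" u "\<theta> - pi" \<theta>]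
      \<open>u \<noteq> 0\<close> norm_u by (simp add: unit_dir_minus_pi flip: u_def)
  moreover have "(Z \<theta> *v (- u)) \<bullet> (- u - u) = 2 * \<gamma> \<theta>"
  proof -
    have "Z \<theta> *v (- u) = - (Z \<theta> *v u)"
      using matrix_vector_mult_diff_distrib[of "Z \<theta>" 0 u] by simp
    moreover have "- u - u = (- 2) *\<^sub>R u"
      by (simp add: scaleR_2)
    ultimately show ?thesis
      using assms(4)[of \<theta>] by (simp add: u_def inner_commute)
  qed
  ultimately show "3 * \<gamma> \<theta> - \<gamma> (\<theta> - pi) \<ge> 0"
    using norm_u by simp
qed

end
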